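(* Consider the storage-concerned economic dispatch problem OP and its relaxation RP (obtained by dropping the complementarity constraints), as defined in the context, and assume OP has a unique global optimal solution $\Omega_0^*$, with optimal value $v_0^*$. Let $\Omega_1^*=(p_i^c(t),p_i^d(t),p_i^g(t))_{i\in\mathcal N,t\in\mathcal T}$ be an optimal solution of RP, with optimal value $v_1^*$, together with a dual solution (multipliers satisfying the KKT conditions of RP with $\Omega_1^*$), and let $LMP_i(t)$ be the associated local marginal prices. If $$LMP_i(t)>\frac{f_i'(p_i^c(t))-\eta_i^c\eta_i^d\,g_i'(p_i^d(t))}{1-\eta_i^c\eta_i^d}\qquad\text{for all } i\in\mathcal N,\ t\in\mathcal T,$$ then $v_1^*=v_0^*$ and $\Omega_1^*=\Omega_0^*$.
   Context: Setting: $\mathcal N$ is a finite set of buses, $\mathcal L$ a finite set of branches, $\mathcal T=\{1,\dots,T\}$ the set of time slots, $\Delta t>0$ the step length. The decision variables are $\Omega=(p_i^c(t),p_i^d(t),p_i^g(t))_{i\in\mathcal N,t\in\mathcal T}$ (real charging power, discharging power, generator output). The objective to be minimized is $$v(\Omega)=\sum_{t\in\mathcal T}\sum_{i\in\mathcal N}\big(g_i(p_i^d(t))-f_i(p_i^c(t))+h_i(p_i^g(t))\big),$$ where $g_i,h_i$ are convex quadratic functions and $f_i$ is a linear function; primes denote derivatives. Real data: bounds $\overline P_i^c,\overline P_i^d,\underline P_i^g,\overline P_i^g,\underline S_i,\overline S_i,R_i^d,R_i^u,\underline P_j^l,\overline P_j^l$; demands $D_i(t)$; coefficients $GSF_{j-i}$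 for $j\in\mathcal L$, $i\in\mathcal N$; initial energies $s_i^0$; self-discharge rates $\varepsilon_i\in[0,1)$; charging and discharging efficiencies $\eta_i^c,\eta_i^d\in(0,1]$ with $\eta_i^c\eta_i^d<1$. The stored energy is $$s_i(t)=(1-\varepsilon_i)^t s_i^0+\sum_{\tau=1}^t(1-\varepsilon_i)^{t-\tau}\big(\eta_i^c p_i^c(\tau)-p_i^d(\tau)/\eta_i^d\big)\Delta t.$$ Constraints (for all $i\in\mathcal N$, $j\in\mathcal L$, $t\in\mathcal T$, the ramp constraint being for $t=1,\dots,T-1$), with multipliers where named: (a) $0\le p_i^c(t)\le\overline P_i^c$, multipliers $\alpha_{i,1}(t)$ (lower), $\alpha_{i,2}(t)$ (upper); (b) $0\le p_i^d(t)\le\overline P_i^d$, multipliers $\alpha_{i,3}(t)$ (lower), $\alpha_{i,4}(t)$ (upper); (c) $p_i^d(t)p_i^c(t)=0$ (complementarity); (d) $\underline P_i^g\le p_i^g(t)\le\overline P_i^g$; (e) $\underline S_i\le s_i(t)\le\overline S_i$, multipliers $\beta_{i,1}(t)$ (lower), $\beta_{i,2}(t)$ (upper); (f) $R_i^d\Delta t\le p_i^g(t+1)-p_i^g(t)\le R_i^u\Delta t$; (g) $\sum_{i\in\mathcal N}(p_i^g(t)+p_i^d(t)-p_i^c(t))=\sum_{i\in\mathcal N}D_i(t)$, multiplier $\lambda(t)$; (h) $\underline P_j^l\le\sum_{i\in\mathcal N}GSF_{j-i}\,(p_i^g(t)+p_i^d(t)-p_i^c(t)-D_i(t))\le\overline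 P_j^l$, multipliers $\mu_{j,1}(t)$ (lower), $\mu_{j,2}(t)$ (upper). OP: minimize $v(\Omega)$ subject to (a)-(h). RP: minimize $v(\Omega)$ subject to (a),(b),(d)-(h), i.e. without (c). Multiplier conventions for RP: multipliers of inequality constraints are nonnegative and satisfy complementary slackness; in the Lagrangian, a lower bound $\underline x\le x$ with multiplier $\mu$ contributes $\mu(\underline x-x)$, an upper bound $x\le\overline x$ with multiplier $\mu$ contributes $\mu(x-\overline x)$, and the balance equation (g) contributes $\lambda(t)\big(\sum_i D_i(t)-\sum_i(p_i^g(t)+p_i^d(t)-p_i^c(t))\big)$. The local marginal price is $$LMP_i(t)=\lambda(t)+\sum_{j\in\mathcal L}GSF_{j-i}\,(\mu_{j,1}(t)-\mu_{j,2}(t)).$$ *)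

theory Defs
  imports "HOL-Analysis.Analysis"
begin

record ('b, 'l) ed_problem =
  buses :: "'b set"
  branches :: "'l set"
  horizon :: nat
  step :: real
  discharge_cost :: "'b \<Rightarrow> real \<Rightarrow> real"  (* g *)
  charge_benefit :: "'b \<Rightarrow> real \<Rightarrow> real"  (* f *)
  gen_cost :: "'b \<Rightarrow> real \<Rightarrow> real"  (* h *)
  Pc_max :: "'b \<Rightarrow> real"
  Pd_max :: "'b \<Rightarrow> real"
  Pg_min :: "'b \<Rightarrow> real"
  Pg_max :: "'b \<Rightarrow> real"
  S_min :: "'b \<Rightarrow> real"
  S_max :: "'b \<Rightarrow> real"
  ramp_min :: "'b \<Rightarrow> real"  (* R^d; enters as a signed lower bound on the rate of change *)
  ramp_max :: "'b \<Rightarrow> real"  (* R^u *)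
  Pl_min :: "'l \<Rightarrow> real"
  Pl_max :: "'l \<Rightarrow> real"
  demand :: "'b \<Rightarrow> nat \<Rightarrow> real"
  GSF :: "'l \<Rightarrow> 'b \<Rightarrow> real"
  init_energy :: "'b \<Rightarrow> real"
  self_discharge :: "'b \<Rightarrow> real"
  eff_c :: "'b \<Rightarrow> real"
  eff_d :: "'b \<Rightarrow> real"

record 'b dispatch =
  pc :: "'b \<Rightarrow> nat \<Rightarrow> real"
  pd :: "'b \<Rightarrow> nat \<Rightarrow> real"
  pg :: "'b \<Rightarrow> nat \<Rightarrow> real"

definition slots :: "('b, 'l) ed_problem \<Rightarrow> nat set" where
  "slots P = {1..horizon P}"

definition ramp_slots :: "('b, 'l) ed_problem \<Rightarrow> nat set" where
  "ramp_slots P = {1..<horizon P}"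

(* The leading coefficient may be 0, e.g. for a bus without storage or generator. *)
definition convex_quadratic :: "(real \<Rightarrow> real) \<Rightarrow> bool" where
  "convex_quadratic q \<longleftrightarrow>
     (\<exists>a b c. \<forall>x. q x = a * x\<^sup>2 + b * x + c) \<and> convex_on UNIV q"

definition well_posed :: "('b, 'l) ed_problem \<Rightarrow> bool" where
  "well_posed P \<longleftrightarrow>
     finite (buses P) \<and> finite (branches P) \<and> 1 \<le> horizon P \<and> 0 < step P \<and>
     (\<forall>i\<in>buses P.
        convex_quadratic (discharge_cost P i) \<and>
        linear (charge_benefit P i) \<and>
        convex_quadratic (gen_cost P i) \<and>
        0 \<le> self_discharge P i \<and> self_discharge P i < 1 \<and>
        0 < eff_c P i \<and> eff_c P i \<le> 1 \<and>
        0 < eff_d P i \<and> eff_d P i \<le> 1 \<and>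
        eff_c P i * eff_d P i < 1)"

definition total_cost :: "('b, 'l) ed_problem \<Rightarrow> 'b dispatch \<Rightarrow> real" where
  "total_cost P \<Omega> =
     (\<Sum>t\<in>slots P. \<Sum>i\<in>buses P.
        discharge_cost P i (pd \<Omega> i t) - charge_benefit P i (pc \<Omega> i t) + gen_cost P i (pg \<Omega> i t))"

definition stored_energy :: "('b, 'l) ed_problem \<Rightarrow> 'b dispatch \<Rightarrow> 'b \<Rightarrow> nat \<Rightarrow> real" where
  "stored_energy P \<Omega> i t =
     (1 - self_discharge P i) ^ t * init_energy P i +
     (\<Sum>\<tau>=1..t. (1 - self_discharge P i) ^ (t - \<tau>) *
        (eff_c P i * pc \<Omega> i \<tau> - pd \<Omega> i \<tau> / eff_d P i) * step P)"

definition injection :: "'b dispatch \<Rightarrow> 'b \<Rightarrow> nat \<Rightarrow> real" where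
  "injection \<Omega> i t = pg \<Omega> i t + pd \<Omega> i t - pc \<Omega> i t"

definition branch_flow :: "('b, 'l) ed_problem \<Rightarrow> 'b dispatch \<Rightarrow> 'l \<Rightarrow> nat \<Rightarrow> real" where
  "branch_flow P \<Omega> j t = (\<Sum>i\<in>buses P. GSF P j i * (injection \<Omega> i t - demand P i t))"

definition RP_feasible :: "('b, 'l) ed_problem \<Rightarrow> 'b dispatch \<Rightarrow> bool" where
  "RP_feasible P \<Omega> \<longleftrightarrow>
     (\<forall>i\<in>buses P. \<forall>t\<in>slots P.
        0 \<le> pc \<Omega> i t \<and> pc \<Omega> i t \<le> Pc_max P i \<and>
        0 \<le> pd \<Omega> i t \<and> pd \<Omega> i t \<le> Pd_max P i \<and>
        Pg_min P i \<le> pg \<Omega> i t \<and> pg \<Omega> i t \<le> Pg_max P i \<and>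
        S_min P i \<le> stored_energy P \<Omega> i t \<and> stored_energy P \<Omega> i t \<le> S_max P i) \<and>
     (\<forall>i\<in>buses P. \<forall>t\<in>ramp_slots P.
        ramp_min P i * step P \<le> pg \<Omega> i (t + 1) - pg \<Omega> i t \<and>
        pg \<Omega> i (t + 1) - pg \<Omega> i t \<le> ramp_max P i * step P) \<and>
     (\<forall>t\<in>slots P. (\<Sum>i\<in>buses P. injection \<Omega> i t) = (\<Sum>i\<in>buses P. demand P i t)) \<and>
     (\<forall>j\<in>branches P. \<forall>t\<in>slots P.
        Pl_min P j \<le> branch_flow P \<Omega> j t \<and> branch_flow P \<Omega> j t \<le> Pl_max P j)"

definition OP_feasible :: "('b, 'l) ed_problem \<Rightarrow> 'b dispatch \<Rightarrow> bool" where
  "OP_feasible P \<Omega> \<longleftrightarrow>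
     RP_feasible P \<Omega> \<and> (\<forall>i\<in>buses P. \<forall>t\<in>slots P. pd \<Omega> i t * pc \<Omega> i t = 0)"

(* Only the entries indexed by buses and time slots are decision variables;
   the values of the underlying total functions elsewhere are meaningless. *)
definition same_dispatch ::
    "('b, 'l) ed_problem \<Rightarrow> 'b dispatch \<Rightarrow> 'b dispatch \<Rightarrow> bool" where
  "same_dispatch P \<Omega> \<Omega>' \<longleftrightarrow>
     (\<forall>i\<in>buses P. \<forall>t\<in>slots P.
        pc \<Omega> i t = pc \<Omega>' i t \<and> pd \<Omega> i t = pd \<Omega>' i t \<and> pg \<Omega> i t = pg \<Omega>' i t)"

(* gam: generator output limits; rho: ramp limits.  Odd indices belong to lower
   bounds, even indices to upper bounds. *)
record ('b, 'l) multipliers =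
  alpha1 :: "'b \<Rightarrow> nat \<Rightarrow> real"
  alpha2 :: "'b \<Rightarrow> nat \<Rightarrow> real"
  alpha3 :: "'b \<Rightarrow> nat \<Rightarrow> real"
  alpha4 :: "'b \<Rightarrow> nat \<Rightarrow> real"
  gam1 :: "'b \<Rightarrow> nat \<Rightarrow> real"
  gam2 :: "'b \<Rightarrow> nat \<Rightarrow> real"
  beta1 :: "'b \<Rightarrow> nat \<Rightarrow> real"
  beta2 :: "'b \<Rightarrow> nat \<Rightarrow> real"
  rho1 :: "'b \<Rightarrow> nat \<Rightarrow> real"
  rho2 :: "'b \<Rightarrow> nat \<Rightarrow> real"
  lam :: "nat \<Rightarrow> real"
  mu1 :: "'l \<Rightarrow> nat \<Rightarrow> real"
  mu2 :: "'l \<Rightarrow> nat \<Rightarrow> real"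

definition RP_lagrangian ::
    "('b, 'l) ed_problem \<Rightarrow> ('b, 'l) multipliers \<Rightarrow> 'b dispatch \<Rightarrow> real" where
  "RP_lagrangian P M \<Omega> =
     total_cost P \<Omega>
     + (\<Sum>i\<in>buses P. \<Sum>t\<in>slots P.
          alpha1 M i t * (0 - pc \<Omega> i t) + alpha2 M i t * (pc \<Omega> i t - Pc_max P i)
        + alpha3 M i t * (0 - pd \<Omega> i t) + alpha4 M i t * (pd \<Omega> i t - Pd_max P i)
        + gam1 M i t * (Pg_min P i - pg \<Omega> i t) + gam2 M i t * (pg \<Omega> i t - Pg_max P i)
        + beta1 M i t * (S_min P i - stored_energy P \<Omega> i t)
        + beta2 M i t * (stored_energy P \<Omega> i t - S_max P i))
     + (\<Sum>i\<in>buses P. \<Sum>t\<in>ramp_slots P.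
          rho1 M i t * (ramp_min P i * step P - (pg \<Omega> i (t + 1) - pg \<Omega> i t))
        + rho2 M i t * (pg \<Omega> i (t + 1) - pg \<Omega> i t - ramp_max P i * step P))
     + (\<Sum>t\<in>slots P.
          lam M t * ((\<Sum>i\<in>buses P. demand P i t) - (\<Sum>i\<in>buses P. injection \<Omega> i t)))
     + (\<Sum>j\<in>branches P. \<Sum>t\<in>slots P.
          mu1 M j t * (Pl_min P j - branch_flow P \<Omega> j t)
        + mu2 M j t * (branch_flow P \<Omega> j t - Pl_max P j))"

definition RP_stationary ::
    "('b, 'l) ed_problem \<Rightarrow> 'b dispatch \<Rightarrow> ('b, 'l) multipliers \<Rightarrow> bool" where
  "RP_stationary P \<Omega> M \<longleftrightarrow>
     (\<forall>i\<in>buses P. \<forall>t\<in>slots P.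
        ((\<lambda>x. RP_lagrangian P M (\<Omega>\<lparr>pc := (pc \<Omega>)(i := (pc \<Omega> i)(t := x))\<rparr>))
           has_real_derivative 0) (at (pc \<Omega> i t)) \<and>
        ((\<lambda>x. RP_lagrangian P M (\<Omega>\<lparr>pd := (pd \<Omega>)(i := (pd \<Omega> i)(t := x))\<rparr>))
           has_real_derivative 0) (at (pd \<Omega> i t)) \<and>
        ((\<lambda>x. RP_lagrangian P M (\<Omega>\<lparr>pg := (pg \<Omega>)(i := (pg \<Omega> i)(t := x))\<rparr>))
           has_real_derivative 0) (at (pg \<Omega> i t)))"

definition RP_dual_feasible ::
    "('b, 'l) ed_problem \<Rightarrow> ('b, 'l) multipliers \<Rightarrow> bool" where
  "RP_dual_feasible P M \<longleftrightarrow>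
     (\<forall>i\<in>buses P. \<forall>t\<in>slots P.
        0 \<le> alpha1 M i t \<and> 0 \<le> alpha2 M i t \<and> 0 \<le> alpha3 M i t \<and> 0 \<le> alpha4 M i t \<and>
        0 \<le> gam1 M i t \<and> 0 \<le> gam2 M i t \<and> 0 \<le> beta1 M i t \<and> 0 \<le> beta2 M i t) \<and>
     (\<forall>i\<in>buses P. \<forall>t\<in>ramp_slots P. 0 \<le> rho1 M i t \<and> 0 \<le> rho2 M i t) \<and>
     (\<forall>j\<in>branches P. \<forall>t\<in>slots P. 0 \<le> mu1 M j t \<and> 0 \<le> mu2 M j t)"

definition RP_compl_slack ::
    "('b, 'l) ed_problem \<Rightarrow> 'b dispatch \<Rightarrow> ('b, 'l) multipliers \<Rightarrow> bool" where
  "RP_compl_slack P \<Omega> M \<longleftrightarrow>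
     (\<forall>i\<in>buses P. \<forall>t\<in>slots P.
        alpha1 M i t * (0 - pc \<Omega> i t) = 0 \<and>
        alpha2 M i t * (pc \<Omega> i t - Pc_max P i) = 0 \<and>
        alpha3 M i t * (0 - pd \<Omega> i t) = 0 \<and>
        alpha4 M i t * (pd \<Omega> i t - Pd_max P i) = 0 \<and>
        gam1 M i t * (Pg_min P i - pg \<Omega> i t) = 0 \<and>
        gam2 M i t * (pg \<Omega> i t - Pg_max P i) = 0 \<and>
        beta1 M i t * (S_min P i - stored_energy P \<Omega> i t) = 0 \<and>
        beta2 M i t * (stored_energy P \<Omega> i t - S_max P i) = 0) \<and>
     (\<forall>i\<in>buses P. \<forall>t\<in>ramp_slots P.
        rho1 M i t * (ramp_min P i * step P - (pg \<Omega> i (t + 1) - pg \<Omega> i t)) = 0 \<and>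
        rho2 M i t * (pg \<Omega> i (t + 1) - pg \<Omega> i t - ramp_max P i * step P) = 0) \<and>
     (\<forall>j\<in>branches P. \<forall>t\<in>slots P.
        mu1 M j t * (Pl_min P j - branch_flow P \<Omega> j t) = 0 \<and>
        mu2 M j t * (branch_flow P \<Omega> j t - Pl_max P j) = 0)"

definition RP_KKT ::
    "('b, 'l) ed_problem \<Rightarrow> 'b dispatch \<Rightarrow> ('b, 'l) multipliers \<Rightarrow> bool" where
  "RP_KKT P \<Omega> M \<longleftrightarrow>
     RP_feasible P \<Omega> \<and> RP_dual_feasible P M \<and> RP_compl_slack P \<Omega> M \<and> RP_stationary P \<Omega> M"

definition LMP ::
    "('b, 'l) ed_problem \<Rightarrow> ('b, 'l) multipliers \<Rightarrow> 'b \<Rightarrow> nat \<Rightarrow> real" where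
  "LMP P M i t = lam M t + (\<Sum>j\<in>branches P. GSF P j i * (mu1 M j t - mu2 M j t))"

end

theory Submission
  imports Defs
begin

text \<open>
  The idea is that charging and discharging at the same bus in the same slot is a way of burning
  energy: raising the charging power by \<open>x\<close> and the discharging power by \<open>eff_c * eff_d * x\<close>
  leaves the stored energy unchanged at all times and withdraws \<open>(1 - eff_c * eff_d) * x\<close> from
  the network. If both powers are positive at an optimum, then they can be lowered in this
  proportion, so that the first-order conditions bound what the withdrawn energy may cost: the
  local marginal price is at most
  \<open>(f' - eff_c * eff_d * g') / (1 - eff_c * eff_d)\<close>. The hypothesis says the opposite.
  So the optimal dispatch of the relaxation satisfies the complementarity constraints, and being
  optimal over a larger feasible set it is also the optimal dispatch of the original problem.

  In terms of multipliers, write \<open>B\<close> for the price that the energy limits of all slots from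
  \<open>t\<close> on put on energy stored in slot \<open>t\<close> (\<open>storage_price\<close> below). Stationarity in the two
  powers reads
  \<open>- f' - alpha1 + alpha2 + eff_c * B + LMP = 0\<close> and
  \<open>g' - alpha3 + alpha4 - B / eff_d - LMP = 0\<close>.
  Both equations come from one exact formula for the change of the Lagrangian when the two powers
  are altered at a single bus and slot (\<open>RP_lagrangian_redispatch\<close>). Adding
  \<open>eff_c * eff_d\<close> times the second equation to the first eliminates \<open>B\<close>, positivity of both
  powers makes \<open>alpha1\<close> and \<open>alpha3\<close> vanish, and the signs of \<open>alpha2\<close> and \<open>alpha4\<close> give the bound
  (\<open>LMP_le_if_simultaneous\<close>).
\<close>

text \<open>
  Both powers are variable at once so that one formula for the Lagrangian yields its partial
  derivatives in either of them.
\<close>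

definition redispatch :: "'b dispatch \<Rightarrow> 'b \<Rightarrow> nat \<Rightarrow> real \<Rightarrow> real \<Rightarrow> 'b dispatch" where
  "redispatch \<Omega> i t x y =
     \<Omega>\<lparr>pc := (pc \<Omega>)(i := (pc \<Omega> i)(t := x)), pd := (pd \<Omega>)(i := (pd \<Omega> i)(t := y))\<rparr>"

text \<open>
  The multipliers of the energy limits enter with the signs they have in the Lagrangian (upper
  minus lower), so that this is the marginal cost of a unit of power reaching the storage in slot
  \<open>t\<close>, of which the fraction \<open>(1 - self_discharge) ^ (\<tau> - t)\<close> is still present in slot \<open>\<tau>\<close>.
\<close>

definition storage_price ::
    "('b, 'l) ed_problem \<Rightarrow> ('b, 'l) multipliers \<Rightarrow> 'b \<Rightarrow> nat \<Rightarrow> real" where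
  "storage_price P M i t =
     (\<Sum>\<tau>\<in>slots P. if t \<le> \<tau>
        then (beta2 M i \<tau> - beta1 M i \<tau>) * (1 - self_discharge P i) ^ (\<tau> - t) * step P else 0)"

lemma sum_sum_single:
  fixes c :: real
  assumes "finite A" "finite B" "a \<in> A" "b \<in> B"
  shows "(\<Sum>x\<in>A. \<Sum>y\<in>B. if x = a \<and> y = b then c else 0) = c"
proof -
  have "(\<Sum>x\<in>A. \<Sum>y\<in>B. if x = a \<and> y = b then c else 0) = (\<Sum>x\<in>A. if x = a then c else 0)"
    using assms by (intro sum.cong refl) auto
  then show ?thesis using assms by simp
qed

lemma redispatch_sel [simp]:
  "pc (redispatch \<Omega> i t x y) k s = (if k = i \<and> s = t then x else pc \<Omega> k s)"
  "pd (redispatch \<Omega> i t x y) k s = (if k = i \<and> s = t then y else pd \<Omega> k s)"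
  "pg (redispatch \<Omega> i t x y) = pg \<Omega>"
  by (auto simp: redispatch_def)

lemma injection_redispatch:
  "injection (redispatch \<Omega> i t x y) k s =
     injection \<Omega> k s + (if k = i \<and> s = t then (y - pd \<Omega> i t) - (x - pc \<Omega> i t) else 0)"
  by (simp add: injection_def)

lemma sum_injection_redispatch:
  assumes "finite (buses P)" "i \<in> buses P"
  shows "(\<Sum>k\<in>buses P. injection (redispatch \<Omega> i t x y) k s) =
    (\<Sum>k\<in>buses P. injection \<Omega> k s) + (if s = t then (y - pd \<Omega> i t) - (x - pc \<Omega> i t) else 0)"
  using assms by (cases "s = t") (simp_all add: injection_redispatch sum.distrib)

lemma branch_flow_redispatch:
  assumes "finite (buses P)" "i \<in> buses P"
  shows "branch_flow P (redispatch \<Omega> i t x y) j s =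
    branch_flow P \<Omega> j s
      + (if s = t then GSF P j i * ((y - pd \<Omega> i t) - (x - pc \<Omega> i t)) else 0)"
proof -
  have "branch_flow P (redispatch \<Omega> i t x y) j s = (\<Sum>k\<in>buses P.
      GSF P j k * (injection \<Omega> k s - demand P k s)
      + (if k = i then if s = t then GSF P j i * ((y - pd \<Omega> i t) - (x - pc \<Omega> i t)) else 0 else 0))"
    unfolding branch_flow_def injection_redispatch
    by (intro sum.cong refl) (auto simp: algebra_simps)
  then show ?thesis
    using assms by (simp add: sum.distrib branch_flow_def)
qed

lemma stored_energy_redispatch:
  assumes "1 \<le> t"
  shows "stored_energy P (redispatch \<Omega> i t x y) k s =
    stored_energy P \<Omega> k s
      + (if k = i \<and> t \<le> s then (1 - self_discharge P i) ^ (s - t)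
           * (eff_c P i * (x - pc \<Omega> i t) - (y - pd \<Omega> i t) / eff_d P i) * step P else 0)"
proof -
  let ?c = "(1 - self_discharge P i) ^ (s - t)
           * (eff_c P i * (x - pc \<Omega> i t) - (y - pd \<Omega> i t) / eff_d P i) * step P"
  have "(\<Sum>\<tau>=1..s. (1 - self_discharge P k) ^ (s - \<tau>) *
        (eff_c P k * pc (redispatch \<Omega> i t x y) k \<tau> - pd (redispatch \<Omega> i t x y) k \<tau> / eff_d P k)
          * step P)
     = (\<Sum>\<tau>=1..s. (1 - self_discharge P k) ^ (s - \<tau>) *
        (eff_c P k * pc \<Omega> k \<tau> - pd \<Omega> k \<tau> / eff_d P k) * step P
        + (if \<tau> = t then if k = i then ?c else 0 else 0))"
    by (intro sum.cong refl) (auto simp: algebra_simps diff_divide_distrib)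
  also have "\<dots> = (\<Sum>\<tau>=1..s. (1 - self_discharge P k) ^ (s - \<tau>) *
        (eff_c P k * pc \<Omega> k \<tau> - pd \<Omega> k \<tau> / eff_d P k) * step P)
        + (if k = i \<and> t \<le> s then ?c else 0)"
    using assms by (simp add: sum.distrib)
  finally show ?thesis
    by (simp add: stored_energy_def)
qed

lemma total_cost_redispatch:
  assumes "finite (buses P)" "i \<in> buses P" "t \<in> slots P"
  shows "total_cost P (redispatch \<Omega> i t x y) = total_cost P \<Omega>
    + (discharge_cost P i y - discharge_cost P i (pd \<Omega> i t))
    - (charge_benefit P i x - charge_benefit P i (pc \<Omega> i t))"
proof -
  let ?c = "(discharge_cost P i y - discharge_cost P i (pd \<Omega> i t))
    - (charge_benefit P i x - charge_benefit P i (pc \<Omega> i t))"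
  have "total_cost P (redispatch \<Omega> i t x y) = (\<Sum>s\<in>slots P. \<Sum>k\<in>buses P.
      (discharge_cost P k (pd \<Omega> k s) - charge_benefit P k (pc \<Omega> k s) + gen_cost P k (pg \<Omega> k s))
      + (if s = t \<and> k = i then ?c else 0))"
    unfolding total_cost_def by (intro sum.cong refl) auto
  also have "\<dots> = total_cost P \<Omega> + ?c"
    using assms unfolding sum.distrib total_cost_def
    by (subst sum_sum_single) (auto simp: slots_def)
  finally show ?thesis by simp
qed

text \<open>
  All constraints are affine in the charging and discharging powers. Hence the change is exact, not
  only of first order, and the prices of stored energy and of injected power appear as
  coefficients.
\<close>

lemma RP_lagrangian_redispatch:
  fixes \<Omega> :: "'b dispatch" and x y :: real
  assumes "finite (buses P)" "i \<in> buses P" "t \<in> slots P"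
  defines "dx \<equiv> x - pc \<Omega> i t" and "dy \<equiv> y - pd \<Omega> i t"
  shows "RP_lagrangian P M (redispatch \<Omega> i t x y) = RP_lagrangian P M \<Omega>
    + (discharge_cost P i y - discharge_cost P i (pd \<Omega> i t))
    - (charge_benefit P i x - charge_benefit P i (pc \<Omega> i t))
    + (alpha2 M i t - alpha1 M i t) * dx + (alpha4 M i t - alpha3 M i t) * dy
    + storage_price P M i t * (eff_c P i * dx - dy / eff_d P i)
    + LMP P M i t * (dx - dy)"
proof -
  let ?\<Omega> = "redispatch \<Omega> i t x y"
  let ?w = "eff_c P i * dx - dy / eff_d P i"
  define box where "box \<Omega>' k s =
          alpha1 M k s * (0 - pc \<Omega>' k s) + alpha2 M k s * (pc \<Omega>' k s - Pc_max P k)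
        + alpha3 M k s * (0 - pd \<Omega>' k s) + alpha4 M k s * (pd \<Omega>' k s - Pd_max P k)
        + gam1 M k s * (Pg_min P k - pg \<Omega>' k s) + gam2 M k s * (pg \<Omega>' k s - Pg_max P k)
        + beta1 M k s * (S_min P k - stored_energy P \<Omega>' k s)
        + beta2 M k s * (stored_energy P \<Omega>' k s - S_max P k)" for \<Omega>' k s
  define ramp where "ramp \<Omega>' k s =
          rho1 M k s * (ramp_min P k * step P - (pg \<Omega>' k (s + 1) - pg \<Omega>' k s))
        + rho2 M k s * (pg \<Omega>' k (s + 1) - pg \<Omega>' k s - ramp_max P k * step P)"
        for \<Omega>' :: "'b dispatch" and k s
  define bal where "bal \<Omega>' s =
          lam M s * ((\<Sum>k\<in>buses P. demand P k s) - (\<Sum>k\<in>buses P. injection \<Omega>' k s))" for \<Omega>' s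
  define flow where "flow \<Omega>' j s =
          mu1 M j s * (Pl_min P j - branch_flow P \<Omega>' j s)
        + mu2 M j s * (branch_flow P \<Omega>' j s - Pl_max P j)" for \<Omega>' j s
  have L: "RP_lagrangian P M \<Omega>' = total_cost P \<Omega>' + (\<Sum>k\<in>buses P. \<Sum>s\<in>slots P. box \<Omega>' k s)
      + (\<Sum>k\<in>buses P. \<Sum>s\<in>ramp_slots P. ramp \<Omega>' k s) + (\<Sum>s\<in>slots P. bal \<Omega>' s)
      + (\<Sum>j\<in>branches P. \<Sum>s\<in>slots P. flow \<Omega>' j s)" for \<Omega>'
    by (simp add: RP_lagrangian_def box_def ramp_def bal_def flow_def)
  have t: "1 \<le> t" and fin: "finite (slots P)"
    using assms by (auto simp: slots_def)
  let ?a = "(alpha2 M i t - alpha1 M i t) * dx + (alpha4 M i t - alpha3 M i t) * dy"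
  let ?b = "\<lambda>s. if t \<le> s
    then (beta2 M i s - beta1 M i s) * (1 - self_discharge P i) ^ (s - t) * step P else 0"
  \<comment> \<open>The power limits are affected in slot \<open>t\<close> alone, the energy limits in all slots from \<open>t\<close> on.\<close>
  have "box ?\<Omega> k s = box \<Omega> k s + (if k = i \<and> s = t then ?a else 0)
      + (if k = i then ?b s * ?w else 0)" for k s
    unfolding box_def stored_energy_redispatch[OF t] redispatch_sel dx_def dy_def
    by (cases "k = i"; cases "s = t"; cases "t \<le> s"; simp; (simp add: algebra_simps)?)
  moreover have "(\<Sum>k\<in>buses P. \<Sum>s\<in>slots P. if k = i then ?b s * ?w else 0)
      = storage_price P M i t * ?w"
  proof -
    have "(\<Sum>k\<in>buses P. \<Sum>s\<in>slots P. if k = i then ?b s * ?w else 0)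
       = (\<Sum>k\<in>buses P. if k = i then \<Sum>s\<in>slots P. ?b s * ?w else 0)"
      by (intro sum.cong refl) auto
    also have "\<dots> = (\<Sum>s\<in>slots P. ?b s * ?w)"
      using assms by simp
    finally show ?thesis
      by (simp only: storage_price_def sum_distrib_right)
  qed
  ultimately have box: "(\<Sum>k\<in>buses P. \<Sum>s\<in>slots P. box ?\<Omega> k s)
      = (\<Sum>k\<in>buses P. \<Sum>s\<in>slots P. box \<Omega> k s) + ?a + storage_price P M i t * ?w"
    using sum_sum_single[OF assms(1) fin assms(2,3)] by (simp only: sum.distrib)
  have ramp: "ramp ?\<Omega> = ramp \<Omega>"
    by (simp add: ramp_def fun_eq_iff)
  have "bal ?\<Omega> s = bal \<Omega> s + (if s = t then lam M t * (dx - dy) else 0)" for s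
    using assms(1,2) by (simp add: bal_def sum_injection_redispatch dx_def dy_def algebra_simps)
  then have bal: "(\<Sum>s\<in>slots P. bal ?\<Omega> s) = (\<Sum>s\<in>slots P. bal \<Omega> s) + lam M t * (dx - dy)"
    using assms(3) fin by (simp add: sum.distrib)
  have "flow ?\<Omega> j s = flow \<Omega> j s
      + (if s = t then GSF P j i * (mu1 M j t - mu2 M j t) * (dx - dy) else 0)" for j s
    using assms(1,2) by (simp add: flow_def branch_flow_redispatch dx_def dy_def algebra_simps)
  then have flow: "(\<Sum>j\<in>branches P. \<Sum>s\<in>slots P. flow ?\<Omega> j s)
      = (\<Sum>j\<in>branches P. \<Sum>s\<in>slots P. flow \<Omega> j s)
      + (\<Sum>j\<in>branches P. GSF P j i * (mu1 M j t - mu2 M j t)) * (dx - dy)"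
    using assms(3) fin by (simp add: sum.distrib sum_distrib_right)
  show ?thesis
    unfolding L box ramp bal flow total_cost_redispatch[OF assms(1-3)] LMP_def
    by (simp add: algebra_simps)
qed

lemma RP_stationary_charging:
  assumes "finite (buses P)" "i \<in> buses P" "t \<in> slots P" "RP_stationary P \<Omega> M"
    and f: "charge_benefit P i differentiable at (pc \<Omega> i t)"
  shows "deriv (charge_benefit P i) (pc \<Omega> i t) =
    alpha2 M i t - alpha1 M i t + storage_price P M i t * eff_c P i + LMP P M i t"
proof -
  let ?f = "charge_benefit P i"
  let ?K = "alpha2 M i t - alpha1 M i t + storage_price P M i t * eff_c P i + LMP P M i t"
  have upd: "\<Omega>\<lparr>pc := (pc \<Omega>)(i := (pc \<Omega> i)(t := x))\<rparr> = redispatch \<Omega> i t x (pd \<Omega> i t)" for x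
    by (cases \<Omega>) (simp add: redispatch_def)
  have L: "RP_lagrangian P M (redispatch \<Omega> i t x (pd \<Omega> i t)) =
      RP_lagrangian P M \<Omega> - (?f x - ?f (pc \<Omega> i t)) + ?K * (x - pc \<Omega> i t)" for x
    unfolding RP_lagrangian_redispatch[OF assms(1-3)] by (simp add: algebra_simps)
  have "(?f has_real_derivative deriv ?f (pc \<Omega> i t)) (at (pc \<Omega> i t))"
    using f by (simp add: DERIV_deriv_iff_real_differentiable)
  then have "((\<lambda>x. RP_lagrangian P M (redispatch \<Omega> i t x (pd \<Omega> i t)))
      has_real_derivative - deriv ?f (pc \<Omega> i t) + ?K) (at (pc \<Omega> i t))"
    unfolding L by (auto intro!: derivative_eq_intros)
  moreover have "((\<lambda>x. RP_lagrangian P M (redispatch \<Omega> i t x (pd \<Omega> i t)))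
      has_real_derivative 0) (at (pc \<Omega> i t))"
    using assms(2-4) unfolding RP_stationary_def upd[symmetric] by blast
  ultimately show ?thesis
    using DERIV_unique by fastforce
qed

lemma RP_stationary_discharging:
  assumes "finite (buses P)" "i \<in> buses P" "t \<in> slots P" "RP_stationary P \<Omega> M"
    and g: "discharge_cost P i differentiable at (pd \<Omega> i t)"
  shows "deriv (discharge_cost P i) (pd \<Omega> i t) =
    alpha3 M i t - alpha4 M i t + storage_price P M i t / eff_d P i + LMP P M i t"
proof -
  let ?g = "discharge_cost P i"
  let ?K = "alpha3 M i t - alpha4 M i t + storage_price P M i t / eff_d P i + LMP P M i t"
  have upd: "\<Omega>\<lparr>pd := (pd \<Omega>)(i := (pd \<Omega> i)(t := y))\<rparr> = redispatch \<Omega> i t (pc \<Omega> i t) y" for y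
    by (cases \<Omega>) (simp add: redispatch_def)
  have L: "RP_lagrangian P M (redispatch \<Omega> i t (pc \<Omega> i t) y) =
      RP_lagrangian P M \<Omega> + (?g y - ?g (pd \<Omega> i t)) - ?K * (y - pd \<Omega> i t)" for y
    unfolding RP_lagrangian_redispatch[OF assms(1-3)]
    by (simp add: algebra_simps diff_divide_distrib)
  have "(?g has_real_derivative deriv ?g (pd \<Omega> i t)) (at (pd \<Omega> i t))"
    using g by (simp add: DERIV_deriv_iff_real_differentiable)
  then have "((\<lambda>y. RP_lagrangian P M (redispatch \<Omega> i t (pc \<Omega> i t) y))
      has_real_derivative deriv ?g (pd \<Omega> i t) - ?K) (at (pd \<Omega> i t))"
    unfolding L by (auto intro!: derivative_eq_intros)
  moreover have "((\<lambda>y. RP_lagrangian P M (redispatch \<Omega> i t (pc \<Omega> i t) y))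
      has_real_derivative 0) (at (pd \<Omega> i t))"
    using assms(2-4) unfolding RP_stationary_def upd[symmetric] by blast
  ultimately show ?thesis
    using DERIV_unique by fastforce
qed

lemma convex_quadratic_differentiable:
  assumes "convex_quadratic q"
  shows "q differentiable at x"
proof -
  obtain a b c where "q = (\<lambda>x. a * x\<^sup>2 + b * x + c)"
    using assms unfolding convex_quadratic_def by blast
  then show ?thesis by simp
qed

text \<open>
  Where both powers are positive, less energy could be burned, so burning it must pay. The weight
  \<open>eff_c * eff_d\<close> is the one for which the storage prices in the two stationarity equations cancel.
\<close>

lemma LMP_le_if_simultaneous:
  assumes P: "well_posed P" and KKT: "RP_KKT P \<Omega> M"
    and it: "i \<in> buses P" "t \<in> slots P"
    and pos: "0 < pc \<Omega> i t" "0 < pd \<Omega> i t"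
  shows "LMP P M i t \<le>
    (deriv (charge_benefit P i) (pc \<Omega> i t)
       - eff_c P i * eff_d P i * deriv (discharge_cost P i) (pd \<Omega> i t))
    / (1 - eff_c P i * eff_d P i)"
proof -
  let ?\<eta> = "eff_c P i * eff_d P i"
  have fin: "finite (buses P)" and quad: "convex_quadratic (discharge_cost P i)"
    and lin: "linear (charge_benefit P i)"
    and eff: "0 < eff_c P i" "0 < eff_d P i" "?\<eta> < 1"
    using P it by (auto simp: well_posed_def)
  have "alpha1 M i t * (0 - pc \<Omega> i t) = 0" "alpha3 M i t * (0 - pd \<Omega> i t) = 0"
    using KKT it unfolding RP_KKT_def RP_compl_slack_def by blast+
  then have lower: "alpha1 M i t = 0" "alpha3 M i t = 0"
    using pos by auto
  have upper: "0 \<le> alpha2 M i t" "0 \<le> alpha4 M i t"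
    using KKT it unfolding RP_KKT_def RP_dual_feasible_def by blast+
  have stat: "RP_stationary P \<Omega> M"
    using KKT by (simp add: RP_KKT_def)
  have charging: "deriv (charge_benefit P i) (pc \<Omega> i t) =
      alpha2 M i t + storage_price P M i t * eff_c P i + LMP P M i t"
    using RP_stationary_charging[OF fin it stat] lower
      linear_imp_differentiable[OF lin] by simp
  have discharging: "deriv (discharge_cost P i) (pd \<Omega> i t) =
      - alpha4 M i t + storage_price P M i t / eff_d P i + LMP P M i t"
    using RP_stationary_discharging[OF fin it stat convex_quadratic_differentiable[OF quad]] lower
    by simp
  have "deriv (charge_benefit P i) (pc \<Omega> i t) - ?\<eta> * deriv (discharge_cost P i) (pd \<Omega> i t)
      = LMP P M i t * (1 - ?\<eta>) + alpha2 M i t + ?\<eta> * alpha4 M i t"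
    unfolding charging discharging using eff by (simp add: field_simps)
  moreover have "0 \<le> ?\<eta> * alpha4 M i t"
    using eff upper by simp
  ultimately show ?thesis
    using upper eff by (simp add: pos_le_divide_eq)
qed

theorem lemma1:
  fixes P :: "('b, 'l) ed_problem"
    and \<Omega>\<^sub>0 \<Omega>\<^sub>1 :: "'b dispatch"
    and M :: "('b, 'l) multipliers"
    and v\<^sub>0 v\<^sub>1 :: real
  assumes "well_posed P"
    and "is_arg_min (total_cost P) (OP_feasible P) \<Omega>\<^sub>0"
    and "\<And>\<Omega>. is_arg_min (total_cost P) (OP_feasible P) \<Omega> \<Longrightarrow> same_dispatch P \<Omega> \<Omega>\<^sub>0"
    and "v\<^sub>0 = total_cost P \<Omega>\<^sub>0"
    and "is_arg_min (total_cost P) (RP_feasible P) \<Omega>\<^sub>1"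
    and "v\<^sub>1 = total_cost P \<Omega>\<^sub>1"
    and "RP_KKT P \<Omega>\<^sub>1 M"
    and "\<And>i t. i \<in> buses P \<Longrightarrow> t \<in> slots P \<Longrightarrow>
           LMP P M i t >
             (deriv (charge_benefit P i) (pc \<Omega>\<^sub>1 i t)
                - eff_c P i * eff_d P i * deriv (discharge_cost P i) (pd \<Omega>\<^sub>1 i t))
             / (1 - eff_c P i * eff_d P i)"
  shows "v\<^sub>1 = v\<^sub>0 \<and> same_dispatch P \<Omega>\<^sub>1 \<Omega>\<^sub>0"
proof -
  have feas: "RP_feasible P \<Omega>\<^sub>1"
    using assms(5) by (simp add: is_arg_min_def)
  have "pd \<Omega>\<^sub>1 i t * pc \<Omega>\<^sub>1 i t = 0" if it: "i \<in> buses P" "t \<in> slots P" for i t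
  proof (rule ccontr)
    assume "pd \<Omega>\<^sub>1 i t * pc \<Omega>\<^sub>1 i t \<noteq> 0"
    moreover have "0 \<le> pc \<Omega>\<^sub>1 i t" "0 \<le> pd \<Omega>\<^sub>1 i t"
      using feas it unfolding RP_feasible_def by blast+
    ultimately have "0 < pc \<Omega>\<^sub>1 i t" "0 < pd \<Omega>\<^sub>1 i t"
      by auto
    from LMP_le_if_simultaneous[OF assms(1,7) it this] assms(8)[OF it] show False
      by linarith
  qed
  with feas have "OP_feasible P \<Omega>\<^sub>1"
    by (simp add: OP_feasible_def)
  then have opt: "is_arg_min (total_cost P) (OP_feasible P) \<Omega>\<^sub>1"
    using assms(5) by (auto simp: is_arg_min_def OP_feasible_def)
  with assms(2) have "total_cost P \<Omega>\<^sub>1 = total_cost P \<Omega>\<^sub>0"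
    by (meson is_arg_min_linorder order_antisym)
  with assms(3)[OF opt] assms(4,6) show ?thesis
    by simp
qed

end
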